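(* Let $\phi\in\Phi$ be such that $\phi\in \mathrm{Conv}_2$, i.e. the function $\lambda\mapsto\phi(|\lambda|^{1/2})$ is convex. Let $\xi$ be a centered random variable with $\xi\in B(\phi)$, and let $\xi_1,\xi_2,\ldots$ be independent copies of $\xi$. Then $$\sup_{n\ge 1}\ \sup_{(a_1,\ldots,a_n)\in D(n)}\ \Big\|\sum_{k=1}^n a_k\xi_k\Big\|_{B(\phi)}=\|\xi\|_{B(\phi)} .$$
   Context: All random variables are real-valued and defined on a sufficiently rich probability space. For $n\ge1$, $D(n)=\{(a_1,\ldots,a_n)\in\mathbb{R}^n:\ \sum_{k=1}^n a_k^2=1\}$. $\Phi$ is the set of all even, twice continuously differentiable, convex functions $\phi:(-\lambda_0,\lambda_0)\to\mathbb{R}$, where $\lambda_0=\lambda_0(\phi)\in(0,\infty]$, that are strictly increasing on $[0,\lambda_0)$, satisfy $\phi(\lambda)\asymp\lambda^2$ as $\lambda\to0$ (two-sided bounds by positive constants times $\lambda^2$), and, if $\lambda_0=\infty$, satisfy $\phi(\lambda)/\lambda\to\infty$ as $\lambda\to\infty$. For $\phi\in\Phi$, a random variable $\zeta$ belongs to $B(\phi)$ if there is a finite $\tau\ge0$ with $\mathbf{E}\exp(\lambda\zeta)\le\exp(\phi(\lambda\tau))$ for all $|\lambda|<\lambda_0$, where $\phi$ is read as $+\infty$ outside $(-\lambda_0,\lambda_0)$. The minimal such $\tau$ is the norm $\|\zeta\|_{B(\phi)}$. $\phi\in\mathrm{Conv}_2$ means that $\lambda\mapsto\phi(|\lambda|^{1/2})$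 is convex (on the set of $\lambda$ with $|\lambda|^{1/2}<\lambda_0$). *)

theory Defs
  imports "HOL-Probability.Probability"
begin

text \<open>
  A function \<open>\<phi> : (-\<lambda>\<^sub>0, \<lambda>\<^sub>0) \<rightarrow> \<real>\<close> with \<open>\<lambda>\<^sub>0 \<in> (0, \<infinity>]\<close> is represented by the pair of
  \<open>l0 :: ereal\<close> and a total function \<open>\<phi> :: real \<Rightarrow> real\<close>, whose values outside
  \<open>(-\<lambda>\<^sub>0, \<lambda>\<^sub>0)\<close> are irrelevant in everything below.
\<close>

definition phi_dom :: "ereal \<Rightarrow> real set" where
  "phi_dom l0 = {x. ereal \<bar>x\<bar> < l0}"

definition twice_cont_diff_on :: "real set \<Rightarrow> (real \<Rightarrow> real) \<Rightarrow> bool" where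
  "twice_cont_diff_on S f \<longleftrightarrow>
     (\<exists>f' f''. (\<forall>x\<in>S. (f has_real_derivative f' x) (at x)) \<and>
               (\<forall>x\<in>S. (f' has_real_derivative f'' x) (at x)) \<and>
               continuous_on S f'')"

definition Phi :: "ereal \<Rightarrow> (real \<Rightarrow> real) \<Rightarrow> bool" where
  "Phi l0 \<phi> \<longleftrightarrow>
     0 < l0 \<and>
     (\<forall>x\<in>phi_dom l0. \<phi> (- x) = \<phi> x) \<and>
     twice_cont_diff_on (phi_dom l0) \<phi> \<and>
     convex_on (phi_dom l0) \<phi> \<and>
     strict_mono_on (phi_dom l0 \<inter> {0..}) \<phi> \<and>
     (\<exists>c>0. \<exists>C>0. eventually (\<lambda>x. c * x\<^sup>2 \<le> \<phi> x \<and> \<phi> x \<le> C * x\<^sup>2) (at 0)) \<and>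
     (l0 = \<infinity> \<longrightarrow> filterlim (\<lambda>x. \<phi> x / x) at_top at_top)"

definition Conv2 :: "ereal \<Rightarrow> (real \<Rightarrow> real) \<Rightarrow> bool" where
  "Conv2 l0 \<phi> \<longleftrightarrow> convex_on {x. ereal (sqrt \<bar>x\<bar>) < l0} (\<lambda>x. \<phi> (sqrt \<bar>x\<bar>))"

text \<open>\<open>exp (\<phi> x)\<close>, with \<open>\<phi>\<close> read as \<open>+\<infinity>\<close> outside its domain.\<close>

definition exp_phi :: "ereal \<Rightarrow> (real \<Rightarrow> real) \<Rightarrow> real \<Rightarrow> ennreal" where
  "exp_phi l0 \<phi> x = (if x \<in> phi_dom l0 then ennreal (exp (\<phi> x)) else \<infinity>)"

text \<open>
  The exponential moment is a nonnegative Lebesgue integral: the Bochner integral would be \<open>0\<close>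
  when the moment is infinite, and the inequality would then hold spuriously.
\<close>

definition B_bound :: "'a measure \<Rightarrow> ereal \<Rightarrow> (real \<Rightarrow> real) \<Rightarrow> ('a \<Rightarrow> real) \<Rightarrow> real \<Rightarrow> bool" where
  "B_bound M l0 \<phi> \<zeta> \<tau> \<longleftrightarrow>
     (\<forall>l\<in>phi_dom l0. (\<integral>\<^sup>+\<omega>. ennreal (exp (l * \<zeta> \<omega>)) \<partial>M) \<le> exp_phi l0 \<phi> (l * \<tau>))"

definition B_space :: "'a measure \<Rightarrow> ereal \<Rightarrow> (real \<Rightarrow> real) \<Rightarrow> ('a \<Rightarrow> real) set" where
  "B_space M l0 \<phi> = {\<zeta> \<in> borel_measurable M. \<exists>\<tau>\<ge>0. B_bound M l0 \<phi> \<zeta> \<tau>}"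

text \<open>
  The norm is extended-valued, equal to \<open>\<infinity>\<close> exactly when no \<open>\<tau>\<close> exists, so that a supremum
  of norms is meaningful without a prior boundedness claim. For \<open>\<phi>\<close> in the class \<open>Phi\<close> the
  infimum over a nonempty set of admissible \<open>\<tau>\<close> is a minimum, by continuity of \<open>\<phi>\<close> on its
  open domain.
\<close>

definition B_norm :: "'a measure \<Rightarrow> ereal \<Rightarrow> (real \<Rightarrow> real) \<Rightarrow> ('a \<Rightarrow> real) \<Rightarrow> ennreal" where
  "B_norm M l0 \<phi> \<zeta> = (INF \<tau>\<in>{\<tau>. 0 \<le> \<tau> \<and> B_bound M l0 \<phi> \<zeta> \<tau>}. ennreal \<tau>)"

text \<open>\<open>\<real>\<^sup>n\<close> is represented by the extensional functions on \<open>{1..n}\<close>.\<close>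

definition D :: "nat \<Rightarrow> (nat \<Rightarrow> real) set" where
  "D n = {a \<in> {1..n} \<rightarrow>\<^sub>E (UNIV :: real set). (\<Sum>k=1..n. (a k)\<^sup>2) = 1}"

definition centered :: "'a measure \<Rightarrow> ('a \<Rightarrow> real) \<Rightarrow> bool" where
  "centered M \<xi> \<longleftrightarrow> integrable M \<xi> \<and> integral\<^sup>L M \<xi> = 0"

definition indep_copies :: "'a measure \<Rightarrow> ('a \<Rightarrow> real) \<Rightarrow> (nat \<Rightarrow> 'a \<Rightarrow> real) \<Rightarrow> bool" where
  "indep_copies M \<xi> X \<longleftrightarrow>
     prob_space.indep_vars M (\<lambda>_. borel) X {1..} \<and>
     (\<forall>k\<ge>1. distr M borel (X k) = distr M borel \<xi>)"

end

theory Submission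
  imports Defs
begin

text \<open>
  If \<open>\<tau>\<close> is admissible for \<open>\<xi>\<close>, then by independence the exponential moment of \<open>\<Sum> a\<^sub>k \<xi>\<^sub>k\<close> at
  \<open>\<lambda>\<close> is at most \<open>exp (\<Sum> \<phi> (a\<^sub>k \<lambda> \<tau>))\<close>. Writing \<open>\<phi> x = \<psi> (x\<^sup>2)\<close> with \<open>\<psi>\<close> convex and
  \<open>\<psi> 0 = 0\<close> gives \<open>\<phi> (a\<^sub>k x) \<le> a\<^sub>k\<^sup>2 \<phi> x\<close>, and summing with \<open>\<Sum> a\<^sub>k\<^sup>2 = 1\<close> shows that \<open>\<tau>\<close> is
  admissible for the sum. The choice \<open>n = 1\<close>, \<open>a\<^sub>1 = 1\<close> attains the bound.
\<close>

lemma phi_dom_mult: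
  assumes "x \<in> phi_dom l0" and "\<bar>a\<bar> \<le> 1"
  shows "a * x \<in> phi_dom l0"
proof -
  have "\<bar>a * x\<bar> \<le> 1 * \<bar>x\<bar>"
    unfolding abs_mult by (rule mult_right_mono) (use assms in auto)
  then have "ereal \<bar>a * x\<bar> \<le> ereal \<bar>x\<bar>"
    by simp
  then show ?thesis
    using assms(1) le_less_trans unfolding phi_dom_def by blast
qed

lemma Phi_abs:
  assumes "Phi l0 \<phi>" and "x \<in> phi_dom l0"
  shows "\<phi> \<bar>x\<bar> = \<phi> x"
  using assms by (auto simp: Phi_def abs_if)

text \<open>The filter \<open>at 0\<close> excludes the point 0, so the quadratic upper bound
  reaches \<open>\<phi> 0\<close> only in the limit, through continuity of \<open>\<phi>\<close> at
  0. This sign lets the term at 0 be dropped from the convexity inequality.\<close>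

lemma Phi_zero_le:
  assumes "Phi l0 \<phi>"
  shows "\<phi> 0 \<le> 0"
proof -
  obtain C where C: "eventually (\<lambda>x. \<phi> x \<le> C * x\<^sup>2) (at 0)"
    using assms by (auto simp: Phi_def eventually_conj_iff)
  have "0 \<in> phi_dom l0"
    using assms by (auto simp: Phi_def phi_dom_def zero_ereal_def)
  then have "isCont \<phi> 0"
    using assms unfolding Phi_def twice_cont_diff_on_def by (blast intro: DERIV_isCont)
  then have "(\<phi> \<longlongrightarrow> \<phi> 0) (at 0)"
    by (simp add: isCont_def)
  moreover have "((\<lambda>x. C * x\<^sup>2) \<longlongrightarrow> C * 0\<^sup>2) (at (0::real))"
    by (intro tendsto_intros)
  ultimately have "\<phi> 0 \<le> C * 0\<^sup>2"
    using tendsto_le[OF trivial_limit_at] C by blast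
  then show ?thesis by simp
qed

lemma Conv2_mult_le:
  assumes "Phi l0 \<phi>" and "Conv2 l0 \<phi>" and x: "x \<in> phi_dom l0" and a: "\<bar>a\<bar> \<le> 1"
  shows "\<phi> (a * x) \<le> a\<^sup>2 * \<phi> x"
proof -
  have a2: "a\<^sup>2 \<le> 1"
    using a by (simp add: abs_square_le_1)
  have "0 < l0"
    using assms(1) by (simp add: Phi_def)
  \<comment> \<open>Convexity in the squared variable, between the points 0 and
    \<open>x\<^sup>2\<close> with weight \<open>a\<^sup>2\<close> on the latter. The square roots
    become \<open>\<bar>a * x\<bar>\<close> and \<open>\<bar>x\<bar>\<close>, and evenness removes
    the absolute values.\<close>
  then have "\<phi> (sqrt \<bar>(1 - a\<^sup>2) *\<^sub>R 0 + a\<^sup>2 *\<^sub>R x\<^sup>2\<bar>)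
      \<le> (1 - a\<^sup>2) * \<phi> (sqrt \<bar>0\<bar>) + a\<^sup>2 * \<phi> (sqrt \<bar>x\<^sup>2\<bar>)"
    using assms(2) x a2 unfolding Conv2_def
    by (intro convex_onD) (auto simp: phi_dom_def zero_ereal_def)
  moreover have "sqrt \<bar>(1 - a\<^sup>2) *\<^sub>R 0 + a\<^sup>2 *\<^sub>R x\<^sup>2\<bar> = \<bar>a * x\<bar>"
    by (simp add: real_sqrt_mult abs_mult)
  moreover have "(1 - a\<^sup>2) * \<phi> 0 \<le> 0"
    using a2 Phi_zero_le[OF assms(1)] by (simp add: mult_nonneg_nonpos)
  ultimately show ?thesis
    using Phi_abs[OF assms(1)] phi_dom_mult[OF x a] x by simp
qed

lemma D_abs_le_1:
  assumes "a \<in> D n" and "k \<in> {1..n}"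
  shows "\<bar>a k\<bar> \<le> 1"
proof -
  have "(a k)\<^sup>2 \<le> (\<Sum>k=1..n. (a k)\<^sup>2)"
    by (rule member_le_sum) (use assms in auto)
  then show ?thesis
    using assms(1) by (simp add: D_def abs_square_le_1)
qed

text \<open>The exponential moment is an integral against the law of the variable, so admissibility
  of \<open>\<tau>\<close> passes between identically distributed variables.\<close>

lemma B_bound_distr_cong:
  assumes "\<xi> \<in> borel_measurable M" and "\<eta> \<in> borel_measurable M"
    and "distr M borel \<eta> = distr M borel \<xi>"
  shows "B_bound M l0 \<phi> \<eta> = B_bound M l0 \<phi> \<xi>"
proof -
  have "(\<integral>\<^sup>+\<omega>. ennreal (exp (l * \<eta> \<omega>)) \<partial>M) = (\<integral>\<^sup>+\<omega>. ennreal (exp (l * \<xi> \<omega>)) \<partial>M)" for l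
    using nn_integral_distr[OF assms(1), of "\<lambda>x. ennreal (exp (l * x))"]
      nn_integral_distr[OF assms(2), of "\<lambda>x. ennreal (exp (l * x))"] assms(3)
    by simp
  then show ?thesis
    by (simp add: B_bound_def fun_eq_iff)
qed

text \<open>The exponential turns the sum into a product of independent nonnegative factors. Working
  in \<open>ennreal\<close> keeps the factorization valid even if some moments are infinite.\<close>

lemma (in prob_space) nn_integral_exp_sum:
  assumes "finite I" and "indep_vars (\<lambda>_. borel) X I"
  shows "(\<integral>\<^sup>+\<omega>. ennreal (exp (l * (\<Sum>k\<in>I. a k * X k \<omega>))) \<partial>M)
    = (\<Prod>k\<in>I. \<integral>\<^sup>+\<omega>. ennreal (exp (l * a k * X k \<omega>)) \<partial>M)"
proof -
  have "indep_vars (\<lambda>_. borel) (\<lambda>k \<omega>. ennreal (exp (l * a k * X k \<omega>))) I"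
    by (rule indep_vars_compose2[OF assms(2)]) simp
  from indep_vars_nn_integral[OF assms(1) this] show ?thesis
    by (simp add: assms(1) sum_distrib_left exp_sum prod_ennreal mult.assoc)
qed

lemma (in prob_space) B_bound_sum:
  assumes "Phi l0 \<phi>" and "Conv2 l0 \<phi>" and "a \<in> D n"
    and indep: "indep_vars (\<lambda>_. borel) X {1..n}"
    and bnd: "\<And>k. k \<in> {1..n} \<Longrightarrow> B_bound M l0 \<phi> (X k) \<tau>"
  shows "B_bound M l0 \<phi> (\<lambda>\<omega>. \<Sum>k=1..n. a k * X k \<omega>) \<tau>"
  unfolding B_bound_def
proof
  fix l assume l: "l \<in> phi_dom l0"
  show "(\<integral>\<^sup>+\<omega>. ennreal (exp (l * (\<Sum>k=1..n. a k * X k \<omega>))) \<partial>M) \<le> exp_phi l0 \<phi> (l * \<tau>)"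
  \<comment> \<open>Outside the domain the right-hand side is \<open>\<infinity>\<close>, so only
    the first case has content.\<close>
  proof (cases "l * \<tau> \<in> phi_dom l0")
    case True
    have le: "(\<integral>\<^sup>+\<omega>. ennreal (exp (l * a k * X k \<omega>)) \<partial>M) \<le> ennreal (exp ((a k)\<^sup>2 * \<phi> (l * \<tau>)))"
      if k: "k \<in> {1..n}" for k
    proof -
      note ak = D_abs_le_1[OF assms(3) k]
      \<comment> \<open>The first membership allows the bound for \<open>X k\<close> to be used at
        \<open>l * a k\<close>; the second makes its right-hand side finite.\<close>
      have "l * a k \<in> phi_dom l0" "a k * (l * \<tau>) \<in> phi_dom l0"
        using phi_dom_mult[OF l ak] phi_dom_mult[OF True ak] by (simp_all add: mult.commute)
      then have "(\<integral>\<^sup>+\<omega>. ennreal (exp (l * a k * X k \<omega>)) \<partial>M) \<le> ennreal (exp (\<phi> (a k * (l * \<tau>))))"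
        using bnd[OF k] by (auto simp: B_bound_def exp_phi_def ac_simps dest!: bspec)
      also have "\<dots> \<le> ennreal (exp ((a k)\<^sup>2 * \<phi> (l * \<tau>)))"
        using Conv2_mult_le[OF assms(1,2) True ak] by (simp add: ennreal_leI)
      finally show ?thesis .
    qed
    have "(\<integral>\<^sup>+\<omega>. ennreal (exp (l * (\<Sum>k=1..n. a k * X k \<omega>))) \<partial>M)
        \<le> (\<Prod>k=1..n. ennreal (exp ((a k)\<^sup>2 * \<phi> (l * \<tau>))))"
      unfolding nn_integral_exp_sum[OF finite_atLeastAtMost indep]
      by (intro prod_mono_ennreal le)
    also have "\<dots> = ennreal (exp ((\<Sum>k=1..n. (a k)\<^sup>2) * \<phi> (l * \<tau>)))"
      by (simp add: prod_ennreal exp_sum sum_distrib_right)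
    also have "\<dots> = exp_phi l0 \<phi> (l * \<tau>)"
      using assms(3) True by (simp add: D_def exp_phi_def)
    finally show ?thesis .
  qed (simp add: exp_phi_def)
qed

theorem theorem3p1:
  fixes M :: "'a measure" and l0 :: ereal and \<phi> :: "real \<Rightarrow> real"
    and \<xi> :: "'a \<Rightarrow> real" and X :: "nat \<Rightarrow> 'a \<Rightarrow> real"
  assumes "prob_space M"
    and "Phi l0 \<phi>"
    and "Conv2 l0 \<phi>"
    and "\<xi> \<in> B_space M l0 \<phi>"
    and "centered M \<xi>"
    and "indep_copies M \<xi> X"
  shows "(SUP n\<in>{1..}. SUP a\<in>D n. B_norm M l0 \<phi> (\<lambda>\<omega>. \<Sum>k=1..n. a k * X k \<omega>))
         = B_norm M l0 \<phi> \<xi>"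
proof (rule antisym)
  interpret prob_space M by fact
  have indep: "indep_vars (\<lambda>_. borel) X {1..}"
    and distr: "\<And>k. 1 \<le> k \<Longrightarrow> distr M borel (X k) = distr M borel \<xi>"
    using assms(6) by (auto simp: indep_copies_def)
  have bnd: "B_bound M l0 \<phi> (X k) = B_bound M l0 \<phi> \<xi>" if "1 \<le> k" for k
  proof (rule B_bound_distr_cong)
    show "\<xi> \<in> borel_measurable M"
      using assms(4) by (simp add: B_space_def)
    show "X k \<in> borel_measurable M"
      using indep that by (simp add: indep_vars_def)
  qed (rule distr[OF that])
  show "(SUP n\<in>{1..}. SUP a\<in>D n. B_norm M l0 \<phi> (\<lambda>\<omega>. \<Sum>k=1..n. a k * X k \<omega>)) \<le> B_norm M l0 \<phi> \<xi>"
  proof (intro SUP_least)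
    fix n :: nat and a assume "a \<in> D n"
    moreover have "indep_vars (\<lambda>_. borel) X {1..n}"
      using indep by (rule indep_vars_subset) auto
    ultimately have "B_bound M l0 \<phi> (\<lambda>\<omega>. \<Sum>k=1..n. a k * X k \<omega>) \<tau>" if "B_bound M l0 \<phi> \<xi> \<tau>" for \<tau>
      using that bnd by (intro B_bound_sum[OF assms(2,3)]) auto
    \<comment> \<open>The infimum for the sum runs over a larger set of \<open>\<tau>\<close>, so
      the norms compare without attainment of either infimum.\<close>
    then show "B_norm M l0 \<phi> (\<lambda>\<omega>. \<Sum>k=1..n. a k * X k \<omega>) \<le> B_norm M l0 \<phi> \<xi>"
      unfolding B_norm_def by (intro INF_superset_mono) auto
  qed
  \<comment> \<open>Elements of \<open>D 1\<close> are extensional, hence the restriction. With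
    \<open>e\<close> the sum collapses to \<open>X 1\<close>, which has the same admissible
    \<open>\<tau>\<close> as \<open>\<xi>\<close>.\<close>
  define e where "e = restrict (\<lambda>_. 1 :: real) {1..1::nat}"
  have "e \<in> D 1"
    by (simp add: e_def D_def)
  moreover have "B_norm M l0 \<phi> \<xi> = B_norm M l0 \<phi> (\<lambda>\<omega>. \<Sum>k=1..1. e k * X k \<omega>)"
    using bnd[of 1] by (simp add: e_def B_norm_def)
  ultimately show "B_norm M l0 \<phi> \<xi> \<le> (SUP n\<in>{1..}. SUP a\<in>D n. B_norm M l0 \<phi> (\<lambda>\<omega>. \<Sum>k=1..n. a k * X k \<omega>))"
    by (intro SUP_upper2[of 1] SUP_upper2[of e]) auto
qed

end
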